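(* For all rooks $r,u\in R_n$, one has $\pi_r\le_{\mathcal{R}}\pi_u$ in $R_n^0$ if and only if $r\le_I u$.
   Context: Rooks of size $n$ are words $r=r_1\dots r_n$ over $\{0,\dots,n\}$ with pairwise distinct nonzero letters; $R_n$ is their set and $1_n=12\cdots n$. $R_n^0$ is the monoid presented by generators $\pi_0,\dots,\pi_{n-1}$ and relations $\pi_i^2=\pi_i$, $\pi_i\pi_{i+1}\pi_i=\pi_{i+1}\pi_i\pi_{i+1}$ ($1\le i\le n-2$), $\pi_1\pi_0\pi_1\pi_0=\pi_0\pi_1\pi_0=\pi_0\pi_1\pi_0\pi_1$, $\pi_i\pi_j=\pi_j\pi_i$ ($|i-j|\ge2$). It acts on the right on $R_n$ by $r\cdot\pi_0=0r_2\cdots r_n$ and, for $k\ge1$, $r\cdot\pi_k$ exchanges $r_k,r_{k+1}$ if $r_k<r_{k+1}$ and fixes $r$ otherwise; for each $r\in R_n$, $\pi_r$ denotes the unique element of $R_n^0$ with $1_n\cdot\pi_r=r$. In a monoid $M$, $x\le_{\mathcal{R}}y$ means $xM\subseteq yM$. For a rook $r$: $\mathrm{supp}(r)$ is its set of nonzero letters, $\mathrm{Inv}(r)=\{(r_i,r_j): i<j,\ r_i>r_j>0\}$, and for $\ell\in\mathrm{supp}(r)$, $Z_r(\ell)$ is the number of zeros after $\ell$ in $r$. Define $r\le_I u$ iff (a) $\mathrm{supp}(r)\subseteq\mathrm{supp}(u)$, (b) $\{(b,a)\in\mathrm{Inv}(u): b\in\mathrm{supp}(r)\}\subseteq\mathrm{Inv}(r)$,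 and (c) $Z_u(\ell)\le Z_r(\ell)$ for all $\ell\in\mathrm{supp}(r)$. *)

theory Defs
  imports "HOL-Library.Multiset" "HOL-Algebra.Coset"
begin

section \<open>Monoids given by generators and relations\<close>

inductive_set gen_cong :: "'a set \<Rightarrow> ('a list \<times> 'a list) set \<Rightarrow> ('a list \<times> 'a list) set"
  for A :: "'a set" and R :: "('a list \<times> 'a list) set" where
  base: "(u, v) \<in> R \<Longrightarrow> u \<in> lists A \<Longrightarrow> v \<in> lists A \<Longrightarrow> (u, v) \<in> gen_cong A R"
| refl: "u \<in> lists A \<Longrightarrow> (u, u) \<in> gen_cong A R"
| sym: "(u, v) \<in> gen_cong A R \<Longrightarrow> (v, u) \<in> gen_cong A R"
| trans: "(u, v) \<in> gen_cong A R \<Longrightarrow> (v, w) \<in> gen_cong A R \<Longrightarrow> (u, w) \<in> gen_cong A R"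
| append: "(u, v) \<in> gen_cong A R \<Longrightarrow> (u', v') \<in> gen_cong A R \<Longrightarrow> (u @ u', v @ v') \<in> gen_cong A R"

definition presented_monoid :: "'a set \<Rightarrow> ('a list \<times> 'a list) set \<Rightarrow> 'a list set monoid" where
  "presented_monoid A R =
     \<lparr>carrier = lists A // gen_cong A R,
      mult = (\<lambda>X Y. \<Union>x\<in>X. \<Union>y\<in>Y. gen_cong A R `` {x @ y}),
      one = gen_cong A R `` {[]}\<rparr>"

lemma gen_cong_lists: "(u, v) \<in> gen_cong A R \<Longrightarrow> u \<in> lists A \<and> v \<in> lists A"
  by (induction rule: gen_cong.induct) auto

lemma equiv_gen_cong: "equiv (lists A) (gen_cong A R)"
proof (rule equivI)
  show "gen_cong A R \<subseteq> lists A \<times> lists A"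
    using gen_cong_lists by fastforce
  show "refl_on (lists A) (gen_cong A R)"
    by (auto simp: refl_on_def intro: gen_cong.refl)
  show "sym (gen_cong A R)"
    by (blast intro: symI gen_cong.sym)
  show "trans (gen_cong A R)"
    by (blast intro: transI gen_cong.trans)
qed

lemma presented_monoid_mult_class:
  assumes "u \<in> lists A" "v \<in> lists A"
  shows "gen_cong A R `` {u} \<otimes>\<^bsub>presented_monoid A R\<^esub> gen_cong A R `` {v} = gen_cong A R `` {u @ v}"
proof -
  have "congruent2 (gen_cong A R) (gen_cong A R) (\<lambda>x y. gen_cong A R `` {x @ y})"
    by (intro congruent2I' equiv_class_eq[OF equiv_gen_cong] gen_cong.append)
  then show ?thesis
    using UN_equiv_class2[OF equiv_gen_cong equiv_gen_cong] assms
    by (simp add: presented_monoid_def)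
qed

lemma monoid_presented_monoid: "monoid (presented_monoid A R)"
proof (rule monoidI)
  let ?M = "presented_monoid A R" and ?c = "\<lambda>u. gen_cong A R `` {u}"
  have car: "carrier ?M = ?c ` lists A"
    by (auto simp: presented_monoid_def quotient_def)
  have one: "\<one>\<^bsub>?M\<^esub> = ?c []"
    by (simp add: presented_monoid_def)
  note m = presented_monoid_mult_class[of _ A _ R]
  show "\<one>\<^bsub>?M\<^esub> \<in> carrier ?M"
    unfolding car one by (rule imageI) simp
  show "x \<otimes>\<^bsub>?M\<^esub> y \<in> carrier ?M" if "x \<in> carrier ?M" "y \<in> carrier ?M" for x y
  proof -
    from that obtain u v where uv: "x = ?c u" "y = ?c v" "u \<in> lists A" "v \<in> lists A"
      unfolding car by blast
    then have "x \<otimes>\<^bsub>?M\<^esub> y = ?c (u @ v)" "u @ v \<in> lists A"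
      by (simp_all add: m)
    then show ?thesis using imageI[of "u @ v" "lists A" ?c] unfolding car by simp
  qed
  show "\<one>\<^bsub>?M\<^esub> \<otimes>\<^bsub>?M\<^esub> x = x" "x \<otimes>\<^bsub>?M\<^esub> \<one>\<^bsub>?M\<^esub> = x" if "x \<in> carrier ?M" for x
  proof -
    from that obtain u where u: "x = ?c u" "u \<in> lists A"
      unfolding car by blast
    have nil: "[] \<in> lists A" by simp
    show "\<one>\<^bsub>?M\<^esub> \<otimes>\<^bsub>?M\<^esub> x = x" "x \<otimes>\<^bsub>?M\<^esub> \<one>\<^bsub>?M\<^esub> = x"
      unfolding one u(1) m[OF nil u(2)] m[OF u(2) nil] by simp_all
  qed
  show "x \<otimes>\<^bsub>?M\<^esub> y \<otimes>\<^bsub>?M\<^esub> z = x \<otimes>\<^bsub>?M\<^esub> (y \<otimes>\<^bsub>?M\<^esub> z)"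
    if "x \<in> carrier ?M" "y \<in> carrier ?M" "z \<in> carrier ?M" for x y z
  proof -
    from that obtain u v w where
      "x = ?c u" "y = ?c v" "z = ?c w" "u \<in> lists A" "v \<in> lists A" "w \<in> lists A"
      unfolding car by blast
    then show ?thesis by (simp add: m)
  qed
qed

text \<open>The relation $x \leq_{\mathcal R} y$, i.e. $xM \subseteq yM$.\<close>

definition R_le :: "('a, 'b) monoid_scheme \<Rightarrow> 'a \<Rightarrow> 'a \<Rightarrow> bool" where
  "R_le M x y \<longleftrightarrow> x <#\<^bsub>M\<^esub> carrier M \<subseteq> y <#\<^bsub>M\<^esub> carrier M"


section \<open>Rooks and the monoid $R_n^0$\<close>

text \<open>Lists are indexed from 0, so the letter $r_k$ is \<open>r ! (k - 1)\<close>.\<close>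

definition rooks :: "nat \<Rightarrow> nat list set" where
  "rooks n = {r. length r = n \<and> set r \<subseteq> {0..n} \<and> distinct (filter (\<lambda>x. x \<noteq> 0) r)}"

definition one_rook :: "nat \<Rightarrow> nat list" where
  "one_rook n = [1..<Suc n]"

definition rook_rels :: "nat \<Rightarrow> (nat list \<times> nat list) set" where
  "rook_rels n =
     {([i, i], [i]) | i. i < n}
     \<union> {([i, i + 1, i], [i + 1, i, i + 1]) | i. 1 \<le> i \<and> i + 1 < n}
     \<union> (if 2 \<le> n then {([1, 0, 1, 0], [0, 1, 0]), ([0, 1, 0], [0, 1, 0, 1])} else {})
     \<union> {([i, j], [j, i]) | i j. i < n \<and> j < n \<and> (i + 2 \<le> j \<or> j + 2 \<le> i)}"

definition rook_monoid0 :: "nat \<Rightarrow> nat list set monoid" where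
  "rook_monoid0 n = presented_monoid {..<n} (rook_rels n)"

text \<open>
  The right action of the generators. Since \<open>act_gen\<close> is a right action, a word acts by
  its letters from left to right.
\<close>

fun act_gen :: "nat list \<Rightarrow> nat \<Rightarrow> nat list" where
  "act_gen r 0 = r[0 := 0]"
| "act_gen r (Suc k) = (if r ! k < r ! Suc k then r[k := r ! Suc k, Suc k := r ! k] else r)"

definition act_word :: "nat list \<Rightarrow> nat list \<Rightarrow> nat list" where
  "act_word r w = foldl act_gen r w"

text \<open>All words in a class act in the same way on a rook; see \<open>rook_act_class\<close> below.\<close>

definition rook_act :: "nat list \<Rightarrow> nat list set \<Rightarrow> nat list" where
  "rook_act r X = the_elem (act_word r ` X)"

text \<open>
  This is a proper description: the map sending \<open>X\<close> to \<open>rook_act (one_rook n) X\<close> is known to be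
  a bijection from the carrier onto \<open>rooks n\<close>. That fact is not established here.
\<close>

definition rook_elem :: "nat \<Rightarrow> nat list \<Rightarrow> nat list set" where
  "rook_elem n r = (THE X. X \<in> carrier (rook_monoid0 n) \<and> rook_act (one_rook n) X = r)"

lemma act_gen_rooks:
  assumes "r \<in> rooks n" "k < n"
  shows "act_gen r k \<in> rooks n"
proof (cases k)
  case 0
  with assms obtain x xs where "r = x # xs" by (cases r) (auto simp: rooks_def)
  with assms 0 show ?thesis by (auto simp: rooks_def split: if_splits)
next
  case (Suc m)
  have len: "length r = n" using assms by (simp add: rooks_def)
  show ?thesis
  proof (cases "r ! m < r ! Suc m")
    case True
    have ms: "mset (act_gen r k) = mset r"
      using True Suc len assms(2) by (simp add: mset_swap)
    then have "mset (filter (\<lambda>x. x \<noteq> 0) (act_gen r k)) = mset (filter (\<lambda>x. x \<noteq> 0) r)"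
      by simp
    then have "distinct (filter (\<lambda>x. x \<noteq> 0) (act_gen r k)) = distinct (filter (\<lambda>x. x \<noteq> 0) r)"
      by (rule mset_eq_imp_distinct_iff)
    moreover have "set (act_gen r k) = set r" "length (act_gen r k) = length r"
      using ms by (auto dest: mset_eq_setD mset_eq_length)
    ultimately show ?thesis using assms by (simp add: rooks_def)
  next
    case False
    then show ?thesis using assms Suc by simp
  qed
qed

lemma act_word_rooks:
  assumes "r \<in> rooks n" "w \<in> lists {..<n}"
  shows "act_word r w \<in> rooks n"
  using assms(2,1)
  by (induction w arbitrary: r rule: lists.induct) (auto simp: act_word_def act_gen_rooks)

lemma act_word_append: "act_word r (u @ v) = act_word (act_word r u) v"
  by (simp add: act_word_def)

lemma nth_act_gen:
  assumes "k < length r" "i < length r"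
  shows "act_gen r k ! i =
    (if k = 0 then (if i = 0 then 0 else r ! i)
     else if i = k - 1 then max (r ! (k - 1)) (r ! k)
     else if i = k then min (r ! (k - 1)) (r ! k) else r ! i)"
  using assms by (cases k) (auto simp: nth_list_update)

lemma length_act_gen [simp]: "length (act_gen r k) = length r"
  by (cases k) auto

lemma length_act_word [simp]: "length (act_word r w) = length r"
  unfolding act_word_def by (induction w arbitrary: r) auto

lemma act_gen_Suc:
  "act_gen r (Suc k) = r[k := max (r ! k) (r ! Suc k), Suc k := min (r ! k) (r ! Suc k)]"
  by (cases "r ! k < r ! Suc k") (simp_all add: max_def min_def)

lemma act_gen_append:
  "act_gen (xs @ a # b # ys) (Suc (length xs)) = xs @ max a b # min a b # ys"
  unfolding act_gen_Suc by (simp add: nth_append list_update_append)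

lemma act_gen_commute:
  assumes "i + 2 \<le> j"
  shows "act_gen (act_gen r i) j = act_gen (act_gen r j) i"
proof -
  obtain b where b: "j = Suc b" using assms by (cases j) auto
  show ?thesis
  proof (cases i)
    case 0
    then have "b \<noteq> 0" using assms b by simp
    with 0 show ?thesis
      unfolding b act_gen_Suc by (simp add: list_update_swap[of 0])
  next
    case (Suc a)
    then have "a \<noteq> b" "Suc a \<noteq> b" "a \<noteq> Suc b" "Suc a \<noteq> Suc b" using assms b by simp_all
    then show ?thesis
      unfolding b Suc act_gen_Suc
      by (simp add: list_update_swap[of a b] list_update_swap[of a "Suc b"]
          list_update_swap[of "Suc a" b] list_update_swap[of "Suc a" "Suc b"] del: nat.inject)
  qed
qed

lemma act_word_rels:
  assumes "(u, v) \<in> rook_rels n" "length r = n"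
  shows "act_word r u = act_word r v"
proof -
  consider (idem) i where "u = [i, i]" "v = [i]" "i < n"
    | (braid) i where "u = [i, i + 1, i]" "v = [i + 1, i, i + 1]" "1 \<le> i" "i + 1 < n"
    | (zero1) "u = [1, 0, 1, 0]" "v = [0, 1, 0]" "2 \<le> n"
    | (zero2) "u = [0, 1, 0]" "v = [0, 1, 0, 1]" "2 \<le> n"
    | (comm) i j where "u = [i, j]" "v = [j, i]" "i < n" "j < n" "i + 2 \<le> j \<or> j + 2 \<le> i"
    using assms(1) unfolding rook_rels_def by (auto split: if_splits)
  then show ?thesis
  proof cases
    case idem
    then show ?thesis using assms(2) by (cases i) (auto simp: act_word_def nth_list_update)
  next
    case braid
    then obtain k where k: "i = Suc k" by (cases i) auto
    let ?xs = "take k r" and ?ys = "drop (Suc (Suc (Suc k))) r"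
    let ?a = "r ! k" and ?b = "r ! Suc k" and ?c = "r ! Suc (Suc k)"
    have len: "length ?xs = k" and r: "r = ?xs @ ?a # ?b # ?c # ?ys"
      using braid k assms(2) by (simp_all add: Cons_nth_drop_Suc)
    have 1: "act_gen (?xs @ x # y # z # ?ys) (Suc k) = ?xs @ max x y # min x y # z # ?ys" for x y z
      using act_gen_append[of ?xs x y "z # ?ys"] unfolding len .
    have 2: "act_gen (?xs @ x # y # z # ?ys) (Suc (Suc k)) = ?xs @ x # max y z # min y z # ?ys" for x y z
      using act_gen_append[of "?xs @ [x]" y z ?ys] len by (simp del: act_gen.simps length_take)
    have "act_word (?xs @ ?a # ?b # ?c # ?ys) u = act_word (?xs @ ?a # ?b # ?c # ?ys) v"
      unfolding braid(1,2) k act_word_def Suc_eq_plus1[symmetric] foldl.simps 1 2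
      by (simp add: max_def min_def)
    then show ?thesis unfolding r[symmetric] .
  next
    case zero1
    then show ?thesis
      using assms(2) by (intro nth_equalityI) (auto simp: act_word_def nth_act_gen simp del: act_gen.simps)
  next
    case zero2
    then show ?thesis
      using assms(2) by (intro nth_equalityI) (auto simp: act_word_def nth_act_gen simp del: act_gen.simps)
  next
    case comm
    then show ?thesis
      using act_gen_commute[of i j r] act_gen_commute[of j i r] by (auto simp: act_word_def)
  qed
qed

lemma act_word_cong:
  assumes "(u, v) \<in> gen_cong {..<n} (rook_rels n)" "r \<in> rooks n"
  shows "act_word r u = act_word r v"
  using assms
proof (induction arbitrary: r rule: gen_cong.induct)
  case (base u v)
  then show ?case by (auto simp: rooks_def intro: act_word_rels)
next
  case (trans u v w)
  then show ?case by metis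
next
  case (append u v u' v')
  from append.hyps(1) append.prems have "act_word r v \<in> rooks n"
    using act_word_rooks gen_cong_lists by blast
  with append show ?case by (simp add: act_word_append)
qed auto

lemma rook_act_class:
  assumes "r \<in> rooks n" "w \<in> lists {..<n}"
  shows "rook_act r (gen_cong {..<n} (rook_rels n) `` {w}) = act_word r w"
proof -
  let ?C = "gen_cong {..<n} (rook_rels n) `` {w}"
  have "w \<in> ?C" using assms(2) by (blast intro: gen_cong.refl)
  moreover have "act_word r v = act_word r w" if "v \<in> ?C" for v
    using act_word_cong[of w v n r] that assms(1) by simp
  ultimately have "act_word r ` ?C = {act_word r w}"
    by blast
  then show ?thesis by (simp add: rook_act_def)
qed

section \<open>The order on rooks\<close>

definition supp :: "nat list \<Rightarrow> nat set" where
  "supp r = set r - {0}"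

definition Inv :: "nat list \<Rightarrow> (nat \<times> nat) set" where
  "Inv r = {(r ! i, r ! j) | i j. i < j \<and> j < length r \<and> r ! i > r ! j \<and> r ! j > 0}"

definition zeros_after :: "nat list \<Rightarrow> nat \<Rightarrow> nat" where
  "zeros_after r l = card {j. j < length r \<and> r ! j = 0 \<and> (\<exists>i<j. r ! i = l)}"

definition rook_le :: "nat list \<Rightarrow> nat list \<Rightarrow> bool" (infix "\<le>\<^sub>I" 50) where
  "r \<le>\<^sub>I u \<longleftrightarrow>
     supp r \<subseteq> supp u
     \<and> {(b, a). (b, a) \<in> Inv u \<and> b \<in> supp r} \<subseteq> Inv r
     \<and> (\<forall>l \<in> supp r. zeros_after u l \<le> zeros_after r l)"

end

theory Submission
  imports Defs
begin

text \<open>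
  Two words are equal in the monoid iff they send the identity rook to the same rook. To see this,
  induct along the action (every generator that moves a rook decreases the weight \<open>wt\<close>): two
  words ending in different steps into the same rook are rewritten, by one defining relation,
  through a common ancestor of the two rooks from which these steps start. Hence \<open>\<pi>\<^sub>r\<close> is a right
  multiple of \<open>\<pi>\<^sub>u\<close> iff \<open>r\<close> lies in the orbit of \<open>u\<close>. Each generator moves a rook down in the order
  \<open>\<le>\<^sub>I\<close>; conversely, if \<open>r \<le>\<^sub>I u\<close> and \<open>r \<noteq> u\<close>, some generator moves \<open>u\<close> to a smaller rook that is
  still above \<open>r\<close>. The case where \<open>u\<close> is the identity rook shows that every rook is reached by a word.
\<close>

section \<open>Inversions and zero counts of concatenated words\<close>

lemma Inv_Nil [simp]: "Inv [] = {}"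
  by (simp add: Inv_def)

lemma Inv_Cons: "Inv (x # xs) = {(x, a) | a. a \<in> set xs \<and> 0 < a \<and> a < x} \<union> Inv xs"
proof (intro subset_antisym subsetI)
  fix z assume "z \<in> Inv (x # xs)"
  then obtain i j where ij: "z = ((x # xs) ! i, (x # xs) ! j)" "i < j" "j < length (x # xs)"
    "(x # xs) ! i > (x # xs) ! j" "(x # xs) ! j > 0"
    unfolding Inv_def by blast
  then obtain j' where j': "j = Suc j'" by (cases j) auto
  show "z \<in> {(x, a) | a. a \<in> set xs \<and> 0 < a \<and> a < x} \<union> Inv xs"
  proof (cases i)
    case 0
    then show ?thesis using ij j' by auto
  next
    case (Suc i')
    then have "z \<in> Inv xs" unfolding Inv_def using ij j' by auto
    then show ?thesis ..
  qed
next
  fix z assume "z \<in> {(x, a) | a. a \<in> set xs \<and> 0 < a \<and> a < x} \<union> Inv xs"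
  then show "z \<in> Inv (x # xs)"
  proof
    assume "z \<in> {(x, a) | a. a \<in> set xs \<and> 0 < a \<and> a < x}"
    then obtain j where "z = (x, xs ! j)" "j < length xs" "0 < xs ! j" "xs ! j < x"
      by (auto simp: in_set_conv_nth)
    then show ?thesis unfolding Inv_def by (intro CollectI exI[of _ 0] exI[of _ "Suc j"]) auto
  next
    assume "z \<in> Inv xs"
    then obtain i j where "z = (xs ! i, xs ! j)" "i < j" "j < length xs" "xs ! i > xs ! j" "xs ! j > 0"
      unfolding Inv_def by blast
    then show ?thesis unfolding Inv_def by (intro CollectI exI[of _ "Suc i"] exI[of _ "Suc j"]) auto
  qed
qed

lemma Inv_append:
  "Inv (xs @ ys) = Inv xs \<union> Inv ys \<union> {(b, a). b \<in> set xs \<and> a \<in> set ys \<and> 0 < a \<and> a < b}"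
  by (induction xs) (auto simp: Inv_Cons)

lemma Inv_subset_supp: "(b, a) \<in> Inv r \<Longrightarrow> b \<in> supp r \<and> a \<in> supp r \<and> a < b"
  by (induction r) (auto simp: Inv_Cons supp_def)

lemma zeros_after_Nil [simp]: "zeros_after [] l = 0"
  by (simp add: zeros_after_def)

text \<open>Only the first occurrence of \<open>l\<close> matters: if it is the head, every zero of
  the tail has an earlier \<open>l\<close>.\<close>

lemma zeros_after_Cons:
  "zeros_after (x # xs) l = (if x = l then count_list xs 0 else zeros_after xs l)"
proof -
  let ?B = "if x = l then {j. j < length xs \<and> xs ! j = 0}
    else {j. j < length xs \<and> xs ! j = 0 \<and> (\<exists>i<j. xs ! i = l)}"
  have "{j. j < length (x # xs) \<and> (x # xs) ! j = 0 \<and> (\<exists>i<j. (x # xs) ! i = l)} = Suc ` ?B"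
    (is "?A = _")
  proof (intro subset_antisym subsetI)
    fix j assume j: "j \<in> ?A"
    then obtain j' where j': "j = Suc j'" by (cases j) auto
    with j have "j' \<in> ?B" by (auto simp: less_Suc_eq_0_disj)
    then show "j \<in> Suc ` ?B" unfolding j' by (rule imageI)
  next
    fix j assume "j \<in> Suc ` ?B"
    then obtain j' where j': "j = Suc j'" "j' \<in> ?B" by (rule imageE)
    then show "j \<in> ?A"
      by (cases "x = l") (auto simp: less_Suc_eq_0_disj)
  qed
  then have "zeros_after (x # xs) l = card ?B"
    unfolding zeros_after_def by (simp only: card_image[OF inj_Suc])
  moreover have "count_list xs 0 = card {j. j < length xs \<and> xs ! j = 0}"
    unfolding count_list_eq_length_filter length_filter_conv_card by metis
  ultimately show ?thesis
    by (simp add: zeros_after_def)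
qed

lemma zeros_after_append:
  "zeros_after (xs @ ys) l =
    (if l \<in> set xs then zeros_after xs l + count_list ys 0 else zeros_after ys l)"
  by (induction xs) (auto simp: zeros_after_Cons)

section \<open>Rearrangements, single generator steps and the weight\<close>

lemma rooks_mset:
  assumes "mset s = mset r" "r \<in> rooks n"
  shows "s \<in> rooks n"
proof -
  have "mset (filter (\<lambda>x. x \<noteq> 0) s) = mset (filter (\<lambda>x. x \<noteq> 0) r)"
    using assms(1) by simp
  then have "distinct (filter (\<lambda>x. x \<noteq> 0) s) = distinct (filter (\<lambda>x. x \<noteq> 0) r)"
    by (rule mset_eq_imp_distinct_iff)
  then show ?thesis
    using assms mset_eq_setD[OF assms(1)] mset_eq_length[OF assms(1)] by (simp add: rooks_def)
qed

lemma one_rook_rooks: "one_rook n \<in> rooks n"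
  by (auto simp: one_rook_def rooks_def)

lemma act_gen_cases:
  assumes "k < length s"
  obtains (zero) x ys where "k = 0" "s = x # ys" "act_gen s k = 0 # ys"
  | (swap) xs a b ys where "k = Suc (length xs)" "s = xs @ a # b # ys"
      "act_gen s k = xs @ max a b # min a b # ys"
proof (cases k)
  case 0
  with assms that(1) show ?thesis by (cases s) auto
next
  case (Suc m)
  let ?xs = "take m s" and ?ys = "drop (Suc (Suc m)) s"
  have len: "length ?xs = m" and s: "s = ?xs @ s ! m # s ! Suc m # ?ys"
    using assms Suc by (simp_all add: Cons_nth_drop_Suc)
  from len have "k = Suc (length ?xs)" using Suc by simp
  with that(2)[OF _ s] show ?thesis using act_gen_append s by metis
qed

text \<open>The sum of each letter times its position, positions counted from 1. Erasing a nonzero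
  first letter lowers it, and so does exchanging adjacent letters \<open>a < b\<close>.\<close>

fun wt :: "nat list \<Rightarrow> nat" where
  "wt [] = 0"
| "wt (x # xs) = x + sum_list xs + wt xs"

lemma wt_append: "wt (xs @ ys) = wt xs + wt ys + length xs * sum_list ys"
  by (induction xs) (auto simp: algebra_simps)

lemma wt_swap: "a < b \<Longrightarrow> wt (xs @ b # a # ys) < wt (xs @ a # b # ys)"
  by (simp add: wt_append algebra_simps)

lemma wt_act_gen_less:
  assumes "k < length s" "act_gen s k \<noteq> s"
  shows "wt (act_gen s k) < wt s"
  using assms(1)
proof (cases rule: act_gen_cases)
  case (zero x ys)
  then show ?thesis using assms(2) by auto
next
  case (swap xs a b ys)
  then show ?thesis using assms(2) wt_swap[of a b xs ys] by (cases a b rule: linorder_cases) (simp_all del: act_gen.simps)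
qed

lemma wt_act_gen_le: "k < length s \<Longrightarrow> wt (act_gen s k) \<le> wt s"
  using wt_act_gen_less[of k s] by (cases "act_gen s k = s") auto

lemma wt_act_word_le:
  "w \<in> lists {..<length s} \<Longrightarrow> wt (act_word s w) \<le> wt s"
proof (induction w arbitrary: s)
  case (Cons k w)
  then have "wt (act_word (act_gen s k) w) \<le> wt (act_gen s k)" by simp
  also have "\<dots> \<le> wt s" using Cons.prems by (simp add: wt_act_gen_le)
  finally show ?case by (simp add: act_word_def)
qed (simp add: act_word_def)


section \<open>The orbits of the action\<close>

lemma rook_le_refl: "r \<le>\<^sub>I r"
  by (auto simp: rook_le_def)

lemma rook_le_trans:
  assumes "r \<le>\<^sub>I s" "s \<le>\<^sub>I u"
  shows "r \<le>\<^sub>I u"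
  using assms unfolding rook_le_def by (blast intro: order_trans)

text \<open>A zero count can change only when a zero passes from the left of \<open>b\<close> to its
  right.\<close>

lemma zeros_after_swap:
  assumes "distinct (filter (\<lambda>x. x \<noteq> 0) (xs @ a # b # ys))" "a < b" "l \<noteq> 0"
  shows "zeros_after (xs @ b # a # ys) l =
    zeros_after (xs @ a # b # ys) l + (if l = b \<and> a = 0 then 1 else 0)"
  using assms by (auto simp: zeros_after_append zeros_after_Cons split: if_splits)

lemma Inv_swap:
  assumes "a < b"
  shows "Inv (xs @ b # a # ys) = Inv (xs @ a # b # ys) \<union> (if a = 0 then {} else {(b, a)})"
  using assms by (auto simp: Inv_append Inv_Cons)

text \<open>Erasing the first letter takes it out of the support and creates a zero that follows no
  letter. An exchange can only add an inversion or a zero after \<open>b\<close>.\<close>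

lemma act_gen_rook_le:
  assumes "u \<in> rooks n" "k < n"
  shows "act_gen u k \<le>\<^sub>I u"
proof -
  have d: "distinct (filter (\<lambda>x. x \<noteq> 0) u)" and k: "k < length u"
    using assms by (auto simp: rooks_def)
  from k show ?thesis
  proof (cases rule: act_gen_cases)
    case (zero x ys)
    then show ?thesis using d
      by (auto simp: rook_le_def supp_def Inv_Cons zeros_after_Cons split: if_splits)
  next
    case (swap xs a b ys)
    show ?thesis
    proof (cases "a < b")
      case True
      then have "act_gen u k = xs @ b # a # ys" using swap by (simp add: max_def min_def del: act_gen.simps)
      then show ?thesis
        using True swap(2) d zeros_after_swap[of xs a b ys] Inv_swap[of a b xs ys]
        by (auto simp: rook_le_def supp_def simp del: act_gen.simps)
    next
      case False
      then show ?thesis using swap by (simp add: max_def min_def rook_le_refl del: act_gen.simps)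
    qed
  qed
qed

lemma act_word_rook_le:
  assumes "u \<in> rooks n" "w \<in> lists {..<n}"
  shows "act_word u w \<le>\<^sub>I u"
  using assms(2,1)
proof (induction w arbitrary: u)
  case (Cons k w)
  then have "act_word (act_gen u k) w \<le>\<^sub>I act_gen u k" by (simp add: act_gen_rooks)
  moreover have "act_gen u k \<le>\<^sub>I u" using Cons by (simp add: act_gen_rook_le)
  ultimately show ?case unfolding act_word_def foldl.simps by (rule rook_le_trans)
qed (simp add: act_word_def rook_le_refl)

section \<open>Steps towards a given smaller rook\<close>

text \<open>The exchange tightens a single condition of the order: the zero count of
  \<open>b\<close> if \<open>a\<close> is zero, the inversion \<open>(b, a)\<close> otherwise. The
  last two premises provide for it.\<close>

lemma rook_le_swap:
  assumes "r \<le>\<^sub>I xs @ a # b # ys" "distinct (filter (\<lambda>x. x \<noteq> 0) (xs @ a # b # ys))" "a < b"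
    and "b \<in> supp r \<Longrightarrow> a = 0 \<Longrightarrow> zeros_after (xs @ a # b # ys) b < zeros_after r b"
    and "b \<in> supp r \<Longrightarrow> a \<noteq> 0 \<Longrightarrow> (b, a) \<in> Inv r"
  shows "r \<le>\<^sub>I xs @ b # a # ys"
proof -
  have "supp (xs @ b # a # ys) = supp (xs @ a # b # ys)" by (auto simp: supp_def)
  moreover have "zeros_after (xs @ b # a # ys) l \<le> zeros_after r l" if "l \<in> supp r" for l
  proof -
    have "l \<noteq> 0" using that by (simp add: supp_def)
    then show ?thesis using zeros_after_swap[OF assms(2,3)] assms(1,4) that
      by (fastforce simp: rook_le_def)
  qed
  ultimately show ?thesis
    using assms(1,5) Inv_swap[OF assms(3), of xs ys] unfolding rook_le_def by (auto split: if_splits)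
qed

text \<open>The new zero stands in front, hence after no letter, and losing \<open>x\<close> only
  removes requirements because \<open>x\<close> is not in \<open>supp r\<close>.\<close>

lemma rook_le_zero:
  assumes "r \<le>\<^sub>I x # ys" "x \<notin> supp r"
  shows "r \<le>\<^sub>I 0 # ys"
proof -
  have "zeros_after (0 # ys) l \<le> zeros_after r l" if "l \<in> supp r" for l
  proof -
    from that assms(2) have "l \<noteq> 0" "l \<noteq> x" by (auto simp: supp_def)
    moreover have "zeros_after (x # ys) l \<le> zeros_after r l"
      using that assms(1) by (simp add: rook_le_def)
    ultimately show ?thesis by (simp add: zeros_after_Cons)
  qed
  moreover have "supp r \<subseteq> supp (0 # ys)" using assms by (auto simp: rook_le_def supp_def)
  moreover have "{(b, a). (b, a) \<in> Inv (0 # ys) \<and> b \<in> supp r} \<subseteq> Inv r"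
    using assms(1) by (auto simp: rook_le_def Inv_Cons)
  ultimately show ?thesis unfolding rook_le_def by blast
qed

lemma rooks_mset_eq:
  assumes "r \<in> rooks n" "u \<in> rooks n" "supp r = supp u"
  shows "mset r = mset u"
proof -
  let ?f = "filter (\<lambda>x. x \<noteq> 0)"
  have "set (?f r) = set (?f u)" using assms(3) by (auto simp: supp_def)
  moreover have d: "distinct (?f r)" "distinct (?f u)" and len: "length r = length u"
    using assms by (auto simp: rooks_def)
  ultimately have f: "mset (?f r) = mset (?f u)" using set_eq_iff_mset_eq_distinct by blast
  have z: "mset (filter (\<lambda>x. \<not> x \<noteq> 0) s) = replicate_mset (length s - length (?f s)) 0" for s :: "nat list"
    by (induction s) (auto simp: Suc_diff_le)
  have "mset s = mset (?f s) + mset (filter (\<lambda>x. \<not> x \<noteq> 0) s)" for s :: "nat list"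
    by (induction s) auto
  then show ?thesis using f z len mset_eq_length[OF f] by metis
qed

lemma last_difference:
  assumes "length r = length u" "r \<noteq> u"
  obtains r' x u' y s where "r = r' @ x # s" "u = u' @ y # s" "x \<noteq> y" "length r' = length u'"
proof -
  have "\<exists>r' x u' y s. r = r' @ x # s \<and> u = u' @ y # s \<and> x \<noteq> y \<and> length r' = length u'"
    using assms
  proof (induction r u rule: rev_induct2)
    case (4 x xs y ys)
    show ?case
    proof (cases "x = y")
      case True
      with 4 obtain r' a u' b s where
        *: "xs = r' @ a # s" "ys = u' @ b # s" "a \<noteq> b" "length r' = length u'" by auto
      show ?thesis unfolding True *
        by (rule exI[of _ r'], rule exI[of _ a], rule exI[of _ u'], rule exI[of _ b],
            rule exI[of _ "s @ [y]"]) (use * in simp)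
    next
      case False
      show ?thesis
        by (rule exI[of _ xs], rule exI[of _ x], rule exI[of _ ys], rule exI[of _ y],
            rule exI[of _ "[]"]) (use False 4 in simp)
    qed
  qed auto
  then show ?thesis using that by blast
qed

text \<open>Some generator brings \<open>u\<close> closer to \<open>r\<close>. If \<open>r\<close> lacks a letter of \<open>u\<close>, the first such
  letter can be moved to the left or erased; otherwise the letter \<open>x\<close> of \<open>r\<close> at the last place
  where \<open>r\<close> and \<open>u\<close> differ can be moved to the right in \<open>u\<close>.\<close>

lemma rook_le_step:
  assumes r: "r \<in> rooks n" and u: "u \<in> rooks n" and le: "r \<le>\<^sub>I u" and ne: "r \<noteq> u"
  obtains k where "k < n" "act_gen u k \<noteq> u" "r \<le>\<^sub>I act_gen u k"
proof -
  note result = that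
  have d: "distinct (filter (\<lambda>x. x \<noteq> 0) u)" and len: "length u = n" "length r = n"
    using r u by (auto simp: rooks_def)
  \<comment> \<open>Except when the first letter can be erased, it remains to find an adjacent
    ascent of \<open>u\<close> whose exchange is compatible with \<open>r\<close>.\<close>
  have swap: thesis if "u = xs @ a # b # ys" "a < b"
    "b \<in> supp r \<Longrightarrow> a = 0 \<Longrightarrow> zeros_after u b < zeros_after r b"
    "b \<in> supp r \<Longrightarrow> a \<noteq> 0 \<Longrightarrow> (b, a) \<in> Inv r" for xs a b ys
  proof -
    have "act_gen u (Suc (length xs)) = xs @ b # a # ys"
      using act_gen_append[of xs a b ys] that by (simp add: max_def min_def del: act_gen.simps)
    then show thesis
      using that rook_le_swap[of r xs a b ys] le d len by (intro result[of "Suc (length xs)"]) auto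
  qed
  show thesis
  proof (cases "supp u \<subseteq> supp r")
    case False
    then have "\<exists>x\<in>set u. x \<noteq> 0 \<and> x \<notin> supp r" by (auto simp: supp_def)
    then obtain xs b ys where split: "u = xs @ b # ys" and b: "b \<noteq> 0 \<and> b \<notin> supp r"
      and xs: "\<forall>x\<in>set xs. \<not> (x \<noteq> 0 \<and> x \<notin> supp r)"
      by (rule split_list_first_propE)
    show thesis
    proof (cases xs rule: rev_cases)
      case Nil
      then show thesis using split b le len rook_le_zero[of r b ys] by (intro that[of 0]) auto
    next
      case (snoc xs' a)
      \<comment> \<open>\<open>b\<close> is the first letter missing from \<open>r\<close>, so a
        larger \<open>a\<close> would lie in \<open>supp r\<close>. The inversion condition would
        then force \<open>(a, b)\<close> upon \<open>r\<close>, which lacks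
        \<open>b\<close>.\<close>
      have "a < b"
      proof (rule ccontr)
        assume "\<not> a < b"
        moreover have "a \<noteq> b" using xs b snoc by auto
        ultimately have ab: "b < a" by simp
        then have "(a, b) \<in> Inv u" using b snoc split by (auto simp: Inv_append Inv_Cons)
        moreover have "a \<in> supp r" using xs snoc ab by auto
        ultimately have "(a, b) \<in> Inv r" using le by (auto simp: rook_le_def)
        then show False using Inv_subset_supp b by blast
      qed
      then show thesis using swap[of xs' a b ys] split snoc b by auto
    qed
  next
    case True
    then have ms: "mset r = mset u"
      using le rooks_mset_eq[OF r u] by (auto simp: rook_le_def)
    obtain r' x u' c s where rs: "r = r' @ x # s" and us: "u = u' @ c # s" and xc: "x \<noteq> c"
      using last_difference[of r u] len ne by metis
    have ms': "mset (r' @ [x]) = mset (u' @ [c])" using ms rs us by simp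
    then have "x \<in> set (u' @ [c])" by (metis in_set_conv_decomp mset_eq_setD)
    \<comment> \<open>If \<open>x\<close> is zero it may occur several times. Taking the last
      occurrence makes the next letter \<open>y\<close> differ from \<open>x\<close>; there is one
      because the final letter is \<open>c\<close>, not \<open>x\<close>.\<close>
    then obtain p q where pq: "u' @ [c] = p @ x # q" "x \<notin> set q" by (meson split_list_last)
    have "q \<noteq> []" using pq xc by auto
    then obtain y q' where q: "q = y # q'" by (cases q) auto
    have u': "u = p @ x # y # q' @ s" using pq q us
      by (metis append.assoc append_Cons append_Nil)
    have yx: "y \<noteq> x" using pq q by auto
    have "y \<in> set (r' @ [x])" using ms' pq q by (metis in_set_conv_decomp mset_eq_setD append_Cons append.assoc append_Nil)
    then have y: "y \<in> set r'" using yx by auto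
    have xr: "x \<noteq> 0 \<Longrightarrow> x \<notin> set r'" "x \<noteq> 0 \<Longrightarrow> x \<notin> set s" "y \<noteq> 0 \<Longrightarrow> y \<notin> set s"
      using r rs y by (auto simp: rooks_def)
    have zx: "zeros_after r x = count_list s 0" if "x \<noteq> 0"
      using rs xr that by (simp add: zeros_after_append zeros_after_Cons)
    have xp: "x \<noteq> 0 \<Longrightarrow> x \<notin> set p" "y \<noteq> 0 \<Longrightarrow> y \<notin> set p" using d u' by auto
    \<comment> \<open>Otherwise \<open>u\<close> would have, after \<open>x\<close>, a zero besides
      those of \<open>s\<close>, or else the inversion \<open>(x, y)\<close>. In \<open>r\<close>
      only \<open>s\<close> follows \<open>x\<close>, and \<open>y\<close> stands before
      \<open>x\<close>.\<close>
    have xy: "x < y"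
    proof (rule ccontr)
      assume "\<not> x < y"
      with yx have lt: "y < x" by simp
      have xs: "x \<in> supp r" using rs lt by (simp add: supp_def)
      show False
      proof (cases "y = 0")
        case True
        then have "zeros_after u x > count_list s 0"
          using u' xp lt by (simp add: zeros_after_append zeros_after_Cons)
        then show False using zx lt le xs by (auto simp: rook_le_def)
      next
        case False
        then have "(x, y) \<in> Inv u" using lt u' by (auto simp: Inv_append Inv_Cons)
        then have "(x, y) \<in> Inv r" using le xs by (auto simp: rook_le_def)
        moreover have "x \<notin> set r'" using xr lt by simp
        moreover have "y \<notin> set s" using xr False by simp
        moreover note xr(2)
        ultimately show False using lt rs Inv_subset_supp[of x y r'] Inv_subset_supp[of x y s]
          by (auto simp: Inv_append Inv_Cons supp_def)
      qed
    qed
    have "zeros_after u y < zeros_after r y" if "x = 0"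
    proof -
      \<comment> \<open>\<open>x\<close> is the last zero before \<open>s\<close> in
        \<open>u\<close>, so only the zeros of \<open>s\<close> follow \<open>y\<close> there. In
        \<open>r\<close> the zero \<open>x\<close> also follows \<open>y\<close>.\<close>
      have "count_list q' 0 = 0" using pq q that by (simp add: count_list_0_iff)
      then have "zeros_after u y = count_list s 0"
        using u' xp yx that by (simp add: zeros_after_append zeros_after_Cons)
      moreover have "zeros_after r y \<ge> Suc (count_list s 0)"
        using rs y that by (simp add: zeros_after_append)
      ultimately show ?thesis by simp
    qed
    moreover have "(y, x) \<in> Inv r" if "x \<noteq> 0"
      using rs y that xy by (auto simp: Inv_append Inv_Cons)
    ultimately show thesis by (intro swap[OF u' xy])
  qed
qed

text \<open>As long as \<open>u\<close> differs from \<open>r\<close>, \<open>rook_le_step\<close>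
  applies, and each step lowers \<open>wt\<close>, so the process ends at \<open>r\<close>.\<close>

lemma rook_le_imp_act_word:
  assumes "r \<in> rooks n" "u \<in> rooks n" "r \<le>\<^sub>I u"
  shows "\<exists>w\<in>lists {..<n}. act_word u w = r"
  using assms(2,3)
proof (induction u rule: measure_induct_rule[where f = wt])
  case (less u)
  show ?case
  proof (cases "r = u")
    case True
    then show ?thesis by (intro bexI[of _ "[]"]) (auto simp: act_word_def)
  next
    case False
    with less.prems assms(1) obtain k where k: "k < n" "act_gen u k \<noteq> u" "r \<le>\<^sub>I act_gen u k"
      using rook_le_step by metis
    moreover have "length u = n" using less.prems by (simp add: rooks_def)
    ultimately obtain w where "w \<in> lists {..<n}" "act_word (act_gen u k) w = r"
      using less.IH[of "act_gen u k"] less.prems wt_act_gen_less act_gen_rooks by blast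
    then show ?thesis using k by (intro bexI[of _ "k # w"]) (auto simp: act_word_def)
  qed
qed

lemma Inv_one_rook: "Inv (one_rook n) = {}"
  by (auto simp: Inv_def one_rook_def simp del: upt_Suc)

lemma rook_le_one_rook:
  assumes "r \<in> rooks n"
  shows "r \<le>\<^sub>I one_rook n"
proof -
  have "zeros_after (one_rook n) l = 0" for l
    by (simp add: zeros_after_def one_rook_def del: upt_Suc)
  moreover have "supp r \<subseteq> supp (one_rook n)"
    using assms by (force simp: rooks_def supp_def one_rook_def)
  ultimately show ?thesis by (auto simp: rook_le_def Inv_one_rook)
qed


section \<open>Faithfulness of the action on the identity rook\<close>

abbreviation rook_cong :: "nat \<Rightarrow> nat list \<Rightarrow> nat list \<Rightarrow> bool" where
  "rook_cong n u v \<equiv> (u, v) \<in> gen_cong {..<n} (rook_rels n)"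

definition rook_words :: "nat \<Rightarrow> nat list \<Rightarrow> nat list set" where
  "rook_words n r = {w \<in> lists {..<n}. act_word (one_rook n) w = r}"

text \<open>Injectivity of the map from the monoid to rooks, localised at the rook \<open>r\<close>
  so that it can serve as an induction hypothesis.\<close>

definition unique_word :: "nat \<Rightarrow> nat list \<Rightarrow> bool" where
  "unique_word n r \<longleftrightarrow> (\<forall>v\<in>rook_words n r. \<forall>w\<in>rook_words n r. rook_cong n v w)"

lemma unique_wordD:
  "unique_word n r \<Longrightarrow> v \<in> rook_words n r \<Longrightarrow> w \<in> rook_words n r \<Longrightarrow> rook_cong n v w"
  by (simp add: unique_word_def)

lemma rook_words_lists: "w \<in> rook_words n r \<Longrightarrow> w \<in> lists {..<n}"
  by (simp add: rook_words_def)

lemma rook_words_append: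
  "v \<in> rook_words n s \<Longrightarrow> w \<in> lists {..<n} \<Longrightarrow> act_word s w = r \<Longrightarrow> v @ w \<in> rook_words n r"
  by (simp add: rook_words_def act_word_append)

lemma rook_words_snoc:
  "v \<in> rook_words n s \<Longrightarrow> i < n \<Longrightarrow> v @ [i] \<in> rook_words n (act_gen s i)"
  by (rule rook_words_append) (simp_all add: act_word_def)

lemma rook_words_nonempty:
  assumes "r \<in> rooks n"
  obtains w where "w \<in> rook_words n r"
  using rook_le_imp_act_word[OF assms one_rook_rooks rook_le_one_rook[OF assms]]
  by (auto simp: rook_words_def)

text \<open>Each rook is reached from the identity rook by steps that never raise the weight. The
  bound makes \<open>wt (one_rook n) - wt r\<close> usable as a measure.\<close>

lemma wt_rook_le:
  assumes "r \<in> rooks n"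
  shows "wt r \<le> wt (one_rook n)"
proof -
  obtain w where "w \<in> rook_words n r" using rook_words_nonempty[OF assms] .
  then show ?thesis using wt_act_word_le[of w "one_rook n"]
    by (simp add: rook_words_def one_rook_def del: upt_Suc)
qed

section \<open>The defining relations as congruences of words\<close>

lemma rook_cong_appendR: "rook_cong n u v \<Longrightarrow> w \<in> lists {..<n} \<Longrightarrow> rook_cong n (u @ w) (v @ w)"
  by (blast intro: gen_cong.append gen_cong.refl)

lemma rook_cong_appendL: "rook_cong n u v \<Longrightarrow> w \<in> lists {..<n} \<Longrightarrow> rook_cong n (w @ u) (w @ v)"
  by (blast intro: gen_cong.append gen_cong.refl)

lemma rook_cong_idem: "i < n \<Longrightarrow> rook_cong n [i, i] [i]"
  by (rule gen_cong.base) (auto simp: rook_rels_def)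

lemma rook_cong_braid: "1 \<le> i \<Longrightarrow> Suc i < n \<Longrightarrow> rook_cong n [i, Suc i, i] [Suc i, i, Suc i]"
  by (rule gen_cong.base) (auto simp: rook_rels_def)

lemma rook_cong_zero:
  assumes "2 \<le> n"
  shows "rook_cong n [Suc 0, 0, Suc 0, 0] [0, Suc 0, 0]" "rook_cong n [0, Suc 0, 0, Suc 0] [0, Suc 0, 0]"
proof -
  show "rook_cong n [Suc 0, 0, Suc 0, 0] [0, Suc 0, 0]"
    using assms by (intro gen_cong.base) (auto simp: rook_rels_def)
  show "rook_cong n [0, Suc 0, 0, Suc 0] [0, Suc 0, 0]"
    using assms by (intro gen_cong.sym[OF gen_cong.base]) (auto simp: rook_rels_def)
qed

lemma rook_cong_commute:
  "i < n \<Longrightarrow> j < n \<Longrightarrow> i + 2 \<le> j \<or> j + 2 \<le> i \<Longrightarrow> rook_cong n [i, j] [j, i]"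
  by (rule gen_cong.base) (auto simp: rook_rels_def)

lemma rook_cong_commute_word:
  assumes "i < n" "w \<in> lists {..<n}" "\<forall>j\<in>set w. i + 2 \<le> j"
  shows "rook_cong n (w @ [i]) (i # w)"
  using assms(2,3)
proof (induction w)
  case Nil
  then show ?case using assms(1) by (auto intro: gen_cong.refl)
next
  case (Cons j w)
  then have jw: "j < n" "w \<in> lists {..<n}" "i + 2 \<le> j" by auto
  have "rook_cong n ([j] @ (w @ [i])) ([j] @ (i # w))"
    using Cons jw by (intro rook_cong_appendL) auto
  moreover have "rook_cong n ([j, i] @ w) ([i, j] @ w)"
    using jw assms(1) by (intro rook_cong_appendR rook_cong_commute) simp_all
  ultimately show ?case by (auto intro: gen_cong.trans)
qed

section \<open>Letters absent from a rook\<close>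

lemma rooks_zero: "x # ys \<in> rooks n \<Longrightarrow> 0 # ys \<in> rooks n"
  by (auto simp: rooks_def split: if_splits)

lemma rooks_fill_zero:
  "0 # ys \<in> rooks n \<Longrightarrow> x \<in> {1..n} \<Longrightarrow> x \<notin> set ys \<Longrightarrow> x # ys \<in> rooks n"
  by (auto simp: rooks_def)

text \<open>There are \<open>n\<close> places for \<open>n\<close> possible nonzero letters without
  repetition, so each zero leaves one letter out. Such letters allow \<open>\<pi>\<^sub>0\<close> to
  be undone.\<close>

lemma card_missing_letters:
  assumes "r \<in> rooks n"
  shows "card ({1..n} - set r) = count_list r 0"
proof -
  let ?f = "filter (\<lambda>x. x \<noteq> 0) r"
  have "distinct ?f" "length r = n" "set ?f \<subseteq> {1..n}"
    using assms by (auto simp: rooks_def)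
  have "card (set ?f) = length ?f" using \<open>distinct ?f\<close> by (rule distinct_card)
  moreover have "length ?f + count_list r 0 = length r" by (induction r) auto
  moreover have "{1..n} - set r = {1..n} - set ?f" by auto
  moreover have "card ({1..n} - set ?f) = n - card (set ?f)"
    using \<open>set ?f \<subseteq> {1..n}\<close> by (simp add: card_Diff_subset)
  ultimately show ?thesis using \<open>length r = n\<close> by simp
qed

lemma missing_letter:
  assumes "0 # ys \<in> rooks n"
  obtains x where "0 < x" "x # ys \<in> rooks n"
proof -
  have "{1..n} - set (0 # ys) \<noteq> {}"
    using card_missing_letters[OF assms] by (metis card.empty count_list.simps(2) nat.distinct(1) add_is_0 one_neq_zero)
  then obtain x where "x \<in> {1..n} - set (0 # ys)" by blast
  then show ?thesis using rooks_fill_zero[OF assms] that[of x] by auto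
qed

lemma two_missing_letters:
  assumes "0 # 0 # ys \<in> rooks n"
  obtains x y where "0 < x" "x < y" "x # y # ys \<in> rooks n"
proof -
  let ?A = "{1..n} - set (0 # 0 # ys)"
  have "\<not> card ?A \<le> Suc 0" unfolding card_missing_letters[OF assms] by simp
  then obtain a b where "a \<in> ?A" "b \<in> ?A" "a \<noteq> b"
    using card_le_Suc0_iff_eq[of ?A] by auto
  then obtain x y where xy: "x \<in> ?A" "y \<in> ?A" "x < y"
    by (metis linorder_neq_iff)
  then have "x # y # ys \<in> rooks n" using assms by (auto simp: rooks_def)
  then show ?thesis using xy by (intro that[of x y]) auto
qed

section \<open>Two steps into the same rook\<close>

lemma act_gen_strict_cases:
  assumes "k < length s" "act_gen s k \<noteq> s"
  obtains (zero) x ys where "k = 0" "s = x # ys" "0 < x" "act_gen s k = 0 # ys"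
  | (swap) xs a b ys where "k = Suc (length xs)" "s = xs @ a # b # ys" "a < b"
      "act_gen s k = xs @ b # a # ys"
  using assms(1)
proof (cases rule: act_gen_cases)
  case (zero x ys)
  then show ?thesis using assms(2) that(1)[of x ys] by (cases "x = 0") auto
next
  case (swap xs a b ys)
  then show ?thesis using assms(2) that(2)[of xs a b ys]
    by (cases a b rule: linorder_cases) (simp_all del: act_gen.simps)
qed

lemma act_gen_swap:
  "a \<le> b \<Longrightarrow> act_gen (xs @ a # b # ys) (Suc (length xs)) = xs @ b # a # ys"
  using act_gen_append[of xs a b ys] by (simp add: max_def min_def del: act_gen.simps)

text \<open>Each generator moves the zero past one letter. If that letter is itself zero nothing
  changes, so \<open>p\<close> may be arbitrary.\<close>

lemma act_word_move_zero:
  "act_word (xs @ 0 # p @ q) [Suc (length xs)..<Suc (length xs + length p)] = xs @ p @ 0 # q"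
proof (induction p arbitrary: xs)
  case (Cons a p)
  have "[Suc (length xs)..<Suc (length xs + length (a # p))] =
      Suc (length xs) # [Suc (length (xs @ [a]))..<Suc (length (xs @ [a]) + length p)]"
    by (simp add: upt_conv_Cons del: upt_Suc)
  moreover have "act_gen (xs @ 0 # (a # p) @ q) (Suc (length xs)) = (xs @ [a]) @ 0 # p @ q"
    using act_gen_swap[of 0 a xs "p @ q"] by simp
  ultimately show ?case using Cons[of "xs @ [a]"]
    by (simp add: act_word_def del: upt_Suc act_gen.simps)
qed (simp add: act_word_def)

text \<open>\<open>\<omega>\<close> stands for a common ancestor: both sides are congruent to
  \<open>\<omega>\<close> followed by the commuting letters \<open>i\<close> and
  \<open>j\<close>.\<close>

lemma rook_cong_diamond_far:
  assumes "\<omega> \<in> lists {..<n}" "i < n" "j < n" "i + 2 \<le> j \<or> j + 2 \<le> i"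
    and "rook_cong n v (\<omega> @ [j])" "rook_cong n w (\<omega> @ [i])"
  shows "rook_cong n (v @ [i]) (w @ [j])"
proof -
  have "rook_cong n (v @ [i]) ((\<omega> @ [j]) @ [i])" using assms by (intro rook_cong_appendR) auto
  moreover have "rook_cong n (\<omega> @ [j, i]) (\<omega> @ [i, j])"
    using assms rook_cong_commute[of j n i] by (intro rook_cong_appendL) auto
  moreover have "rook_cong n ((\<omega> @ [i]) @ [j]) (w @ [j])"
    using assms gen_cong.sym by (intro rook_cong_appendR) auto
  ultimately show ?thesis by (auto intro: gen_cong.trans)
qed

lemma rook_cong_diamond_braid:
  assumes "\<omega> \<in> lists {..<n}" "1 \<le> i" "Suc i < n"
    and "rook_cong n v (\<omega> @ [i, Suc i])" "rook_cong n w (\<omega> @ [Suc i, i])"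
  shows "rook_cong n (v @ [i]) (w @ [Suc i])"
proof -
  have "rook_cong n (v @ [i]) ((\<omega> @ [i, Suc i]) @ [i])" using assms by (intro rook_cong_appendR) auto
  moreover have "rook_cong n (\<omega> @ [i, Suc i, i]) (\<omega> @ [Suc i, i, Suc i])"
    using assms rook_cong_braid by (intro rook_cong_appendL) auto
  moreover have "rook_cong n ((\<omega> @ [Suc i, i]) @ [Suc i]) (w @ [Suc i])"
    using assms gen_cong.sym by (intro rook_cong_appendR) auto
  ultimately show ?thesis by (auto intro: gen_cong.trans)
qed

text \<open>Both rooks come from \<open>x # y # p @ q\<close>, the zero being moved across \<open>p\<close> by generators that
  commute with the last \<open>\<pi>\<^sub>0\<close>; this reduces the claim to the relation \<open>1010 = 010\<close>.\<close>

lemma rook_cong_zero_zero: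
  assumes s: "x # ys \<in> rooks n" and t: "y # ys \<in> rooks n" and x: "0 < x" "x < y"
    and U: "unique_word n (x # ys)" "unique_word n (y # ys)"
    and v: "v \<in> rook_words n (x # ys)" and w: "w \<in> rook_words n (y # ys)"
  shows "rook_cong n (v @ [0]) (w @ [0])"
proof -
  have len: "length ys + 1 = n" using s by (simp add: rooks_def)
  have y: "y \<in> {1..n} - set (x # ys)" using t x by (auto simp: rooks_def)
  \<comment> \<open>The letter \<open>y\<close> is absent from \<open>x # ys\<close>, so this rook
    has a zero, and it lies in \<open>ys\<close> because \<open>x\<close> is nonzero.\<close>
  have "card ({1..n} - set (x # ys)) \<noteq> 0" using y by auto
  then have "0 \<in> set ys"
    unfolding card_missing_letters[OF s] using x by (auto simp: count_list_0_iff split: if_splits)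
  then obtain p q where pq: "ys = p @ 0 # q" by (meson split_list)
  have c: "x # y # p @ q \<in> rooks n"
    using s t x unfolding pq by (auto simp: rooks_def)
  obtain \<omega> where \<omega>: "\<omega> \<in> rook_words n (x # y # p @ q)" using rook_words_nonempty[OF c] .
  have \<omega>l: "\<omega> \<in> lists {..<n}" using rook_words_lists[OF \<omega>] .
  have n: "2 \<le> n" "length p + 2 \<le> n" using len pq by auto
  let ?m = "[2..<2 + length p]"
  have ml: "?m \<in> lists {..<n}" using n by auto
  have m: "act_word (z # 0 # p @ q) ?m = z # ys" for z
    using act_word_move_zero[of "[z]" p q] pq by (simp add: numeral_2_eq_2 del: upt_Suc)
  have m0: "rook_cong n (?m @ [0]) (0 # ?m)"
    using n ml by (intro rook_cong_commute_word) auto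
  have "act_word (x # y # p @ q) [0, Suc 0] = y # 0 # p @ q"
    using x by (simp add: act_word_def)
  then have "act_word (x # y # p @ q) ([0, Suc 0] @ ?m) = y # ys"
    unfolding act_word_append using m by simp
  then have "\<omega> @ [0, Suc 0] @ ?m \<in> rook_words n (y # ys)"
    using \<omega> ml n by (intro rook_words_append[OF \<omega>]) auto
  then have "rook_cong n (\<omega> @ [0, Suc 0] @ ?m) w" using U(2) w by (auto intro: unique_wordD)
  then have W: "rook_cong n ((\<omega> @ [0, Suc 0] @ ?m) @ [0]) (w @ [0])"
    using n by (intro rook_cong_appendR) auto
  \<comment> \<open>\<open>\<pi>\<^sub>1\<close> brings \<open>y\<close> to the front,
    \<open>\<pi>\<^sub>0\<close> erases it and \<open>\<pi>\<^sub>1\<close> brings \<open>x\<close>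
    back. For the other rook \<open>x\<close> was erased directly.\<close>
  have "act_word (x # y # p @ q) [Suc 0, 0, Suc 0] = x # 0 # p @ q"
    using x by (simp add: act_word_def)
  then have "act_word (x # y # p @ q) ([Suc 0, 0, Suc 0] @ ?m) = x # ys"
    unfolding act_word_append using m by simp
  then have "\<omega> @ [Suc 0, 0, Suc 0] @ ?m \<in> rook_words n (x # ys)"
    using \<omega> ml n by (intro rook_words_append[OF \<omega>]) auto
  then have "rook_cong n v (\<omega> @ [Suc 0, 0, Suc 0] @ ?m)" using U(1) v by (auto intro: unique_wordD)
  then have V: "rook_cong n (v @ [0]) ((\<omega> @ [Suc 0, 0, Suc 0] @ ?m) @ [0])"
    using n by (intro rook_cong_appendR) auto
  have 1: "rook_cong n ((\<omega> @ a) @ (?m @ [0])) ((\<omega> @ a) @ (0 # ?m))" if "a \<in> lists {..<n}" for a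
    using that \<omega>l by (intro rook_cong_appendL[OF m0]) auto
  have 2: "rook_cong n (\<omega> @ [Suc 0, 0, Suc 0, 0] @ ?m) (\<omega> @ [0, Suc 0, 0] @ ?m)"
    using \<omega>l ml n rook_cong_zero(1) by (intro rook_cong_appendL rook_cong_appendR)
  note [trans] = gen_cong.trans
  note V
  also have "rook_cong n ((\<omega> @ [Suc 0, 0, Suc 0] @ ?m) @ [0]) (\<omega> @ [Suc 0, 0, Suc 0, 0] @ ?m)"
    using 1[of "[Suc 0, 0, Suc 0]"] n by simp
  also note 2
  also have "rook_cong n (\<omega> @ [0, Suc 0, 0] @ ?m) ((\<omega> @ [0, Suc 0] @ ?m) @ [0])"
    using gen_cong.sym[OF 1[of "[0, Suc 0]"]] n by simp
  also note W
  finally show ?thesis .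
qed

text \<open>Exchanges at the same place have equal predecessors. At neighbouring places the rook
  contains the descending run \<open>b\<close>, \<open>a\<close>, \<open>a'\<close>, the ancestor
  has it ascending, and the braid relation applies. Exchanges further apart commute, and the
  ancestor undoes both.\<close>

lemma rook_cong_swap_swap:
  assumes s: "xs @ a # b # ys \<in> rooks n" and t: "xs' @ a' # b' # ys' \<in> rooks n"
    and eq: "xs @ b # a # ys = xs' @ b' # a' # ys'" and lt: "a < b" "a' < b'"
    and le: "length xs \<le> length xs'"
    and U: "unique_word n (xs @ a # b # ys)" "unique_word n (xs' @ a' # b' # ys')"
    and v: "v \<in> rook_words n (xs @ a # b # ys)" and w: "w \<in> rook_words n (xs' @ a' # b' # ys')"
  shows "rook_cong n (v @ [Suc (length xs)]) (w @ [Suc (length xs')])"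
proof -
  have "xs = take (length xs) xs'"
    using arg_cong[OF eq, of "take (length xs)"] le by simp
  then obtain zs where xs': "xs' = xs @ zs" by (metis append_take_drop_id)
  then have eq': "b # a # ys = zs @ b' # a' # ys'" using eq by simp
  have len: "length xs' + 2 + length ys' = n" using t by (simp add: rooks_def)
  consider "zs = []" | "zs = [b]" | zs' where "zs = b # a # zs'"
    using eq' by (cases zs; cases "tl zs") auto
  then show ?thesis
  proof cases
    case 1
    then have "rook_cong n v w" using U v w eq' xs' by (auto intro: unique_wordD)
    then show ?thesis using 1 xs' len by (auto intro!: rook_cong_appendR)
  next
    case 2
    then have e: "b' = a" "ys = a' # ys'" "xs' = xs @ [b]" using eq' xs' by auto
    let ?k = "Suc (length xs)"
    have c: "xs @ a' # a # b # ys' \<in> rooks n" by (rule rooks_mset[OF _ s]) (simp add: e)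
    obtain \<omega> where \<omega>: "\<omega> \<in> rook_words n (xs @ a' # a # b # ys')" using rook_words_nonempty[OF c] .
    have k: "Suc ?k < n" using len e by simp
    have sw: "act_gen (xs @ z # c # d # ys') (Suc ?k) = xs @ z # d # c # ys'" if "c < d" for z c d
      using act_gen_swap[of c d "xs @ [z]" ys'] that by (simp del: act_gen.simps)
    have "act_word (xs @ a' # a # b # ys') [?k, Suc ?k] = xs @ a # b # ys"
      using lt e by (simp add: act_word_def act_gen_swap sw del: act_gen.simps)
    then have "\<omega> @ [?k, Suc ?k] \<in> rook_words n (xs @ a # b # ys)"
      using k by (intro rook_words_append[OF \<omega>]) auto
    then have V: "rook_cong n v (\<omega> @ [?k, Suc ?k])" using U v by (auto intro: unique_wordD)
    have "act_word (xs @ a' # a # b # ys') [Suc ?k, ?k] = xs' @ a' # b' # ys'"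
      using lt e by (simp add: act_word_def act_gen_swap sw del: act_gen.simps)
    then have "\<omega> @ [Suc ?k, ?k] \<in> rook_words n (xs' @ a' # b' # ys')"
      using k by (intro rook_words_append[OF \<omega>]) auto
    then have W: "rook_cong n w (\<omega> @ [Suc ?k, ?k])" using U w by (auto intro: unique_wordD)
    show ?thesis
      using rook_cong_diamond_braid[OF rook_words_lists[OF \<omega>] _ k V W] e by simp
  next
    case 3
    then have e: "ys = zs' @ b' # a' # ys'" "xs' = xs @ b # a # zs'" using eq' xs' by auto
    let ?c = "xs @ a # b # zs' @ a' # b' # ys'"
    let ?i = "Suc (length xs)" and ?j = "Suc (length xs')"
    have c: "?c \<in> rooks n" by (rule rooks_mset[OF _ s]) (simp add: e)
    obtain \<omega> where \<omega>: "\<omega> \<in> rook_words n ?c" using rook_words_nonempty[OF c] .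
    have ij: "?i < n" "?j < n" "?i + 2 \<le> ?j" using len e by auto
    have "act_gen ?c ?j = xs @ a # b # ys"
      using act_gen_swap[of a' b' "xs @ a # b # zs'" ys'] lt e by (simp del: act_gen.simps)
    then have "\<omega> @ [?j] \<in> rook_words n (xs @ a # b # ys)"
      using rook_words_snoc[OF \<omega>, of ?j] ij by simp
    then have V: "rook_cong n v (\<omega> @ [?j])" using U v by (auto intro: unique_wordD)
    have "act_gen ?c ?i = xs' @ a' # b' # ys'"
      using lt e by (simp add: act_gen_swap del: act_gen.simps)
    then have "\<omega> @ [?i] \<in> rook_words n (xs' @ a' # b' # ys')"
      using rook_words_snoc[OF \<omega>, of ?i] ij by simp
    then have W: "rook_cong n w (\<omega> @ [?i])" using U w by (auto intro: unique_wordD)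
    show ?thesis
      using rook_cong_diamond_far[OF rook_words_lists[OF \<omega>] ij(1,2) _ V W] ij by blast
  qed
qed

text \<open>The exchange leaves the positive letter \<open>b\<close> in front of \<open>a\<close>,
  so it does not touch the leading zero. Its index is at least 2 and it commutes with
  \<open>\<pi>\<^sub>0\<close>.\<close>

lemma rook_cong_zero_swap:
  assumes s: "x # ys \<in> rooks n" and t: "xs @ a # b # zs \<in> rooks n"
    and eq: "0 # ys = xs @ b # a # zs" and lt: "a < b"
    and U: "unique_word n (x # ys)" "unique_word n (xs @ a # b # zs)"
    and v: "v \<in> rook_words n (x # ys)" and w: "w \<in> rook_words n (xs @ a # b # zs)"
  shows "rook_cong n (v @ [0]) (w @ [Suc (length xs)])"
proof -
  obtain xs' where e: "xs = 0 # xs'" "ys = xs' @ b # a # zs" using eq lt by (cases xs) auto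
  let ?c = "x # xs' @ a # b # zs" and ?j = "Suc (length xs)"
  have c: "?c \<in> rooks n" by (rule rooks_mset[OF _ s]) (simp add: e)
  obtain \<omega> where \<omega>: "\<omega> \<in> rook_words n ?c" using rook_words_nonempty[OF c] .
  have ij: "0 < n" "?j < n" "0 + 2 \<le> ?j" using t e by (auto simp: rooks_def)
  have "act_gen ?c ?j = x # ys"
    using act_gen_swap[of a b "x # xs'" zs] lt e by (simp del: act_gen.simps)
  then have "\<omega> @ [?j] \<in> rook_words n (x # ys)" using rook_words_snoc[OF \<omega>, of ?j] ij by simp
  then have V: "rook_cong n v (\<omega> @ [?j])" using U v by (auto intro: unique_wordD)
  have "\<omega> @ [0] \<in> rook_words n (xs @ a # b # zs)" using rook_words_snoc[OF \<omega>, of 0] ij e by simp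
  then have W: "rook_cong n w (\<omega> @ [0])" using U w by (auto intro: unique_wordD)
  show ?thesis
    using rook_cong_diamond_far[OF rook_words_lists[OF \<omega>] ij(1,2) _ V W] ij by blast
qed

lemma rook_cong_predecessors:
  assumes s: "s \<in> rooks n" and t: "t \<in> rooks n" and ij: "i < n" "j < n"
    and eq: "act_gen s i = act_gen t j" and ne: "act_gen s i \<noteq> s" "act_gen t j \<noteq> t"
    and U: "unique_word n s" "unique_word n t"
    and v: "v \<in> rook_words n s" and w: "w \<in> rook_words n t"
  shows "rook_cong n (v @ [i]) (w @ [j])"
proof -
  have len: "i < length s" "j < length t" using s t ij by (auto simp: rooks_def)
  from len(1) ne(1) show ?thesis
  proof (cases rule: act_gen_strict_cases)
    case i: (zero x ys)
    from len(2) ne(2) show ?thesis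
    proof (cases rule: act_gen_strict_cases)
      case j: (zero y zs)
      have e: "zs = ys" using i j eq by simp
      show ?thesis
      proof (cases x y rule: linorder_cases)
        case less
        then show ?thesis using rook_cong_zero_zero[of x ys n y v w] s t i j e U v w by simp
      next
        case equal
        then have "rook_cong n v w" using U v w i j e by (auto intro: unique_wordD)
        then show ?thesis using i j ij by (auto intro!: rook_cong_appendR)
      next
        case greater
        then show ?thesis
          using gen_cong.sym[OF rook_cong_zero_zero[of y ys n x w v]] s t i j e U v w by simp
      qed
    next
      case j: (swap xs a b zs)
      then show ?thesis using rook_cong_zero_swap[of x ys n xs a b zs v w] s t i eq U v w by simp
    qed
  next
    case i: (swap xs a b ys)
    from len(2) ne(2) show ?thesis
    proof (cases rule: act_gen_strict_cases)
      case j: (zero y zs)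
      then show ?thesis
        using gen_cong.sym[OF rook_cong_zero_swap[of y zs n xs a b ys w v]] s t i eq U v w by simp
    next
      case j: (swap xs' a' b' ys')
      then have e: "xs @ b # a # ys = xs' @ b' # a' # ys'" using i eq by simp
      show ?thesis
      proof (cases "length xs \<le> length xs'")
        case True
        then show ?thesis
          using rook_cong_swap_swap[OF _ _ e _ _ True] s t i j U v w by simp
      next
        case False
        then show ?thesis
          using gen_cong.sym[OF rook_cong_swap_swap[OF _ _ e[symmetric]]] s t i j U v w by simp
      qed
    qed
  qed
qed

section \<open>Generators that fix a rook\<close>

text \<open>By uniqueness every word for \<open>s\<close> absorbs a generator that fixes
  \<open>s\<close>; commuting \<open>i\<close> past \<open>j\<close> carries this over to
  \<open>v @ [j]\<close>.\<close>

lemma absorbed_far: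
  assumes "unique_word n s" "act_gen s i = s" "i < n" "j < n" "i + 2 \<le> j \<or> j + 2 \<le> i"
    "v \<in> rook_words n s"
  shows "rook_cong n (v @ [j, i]) (v @ [j])"
proof -
  have v: "v \<in> lists {..<n}" using assms rook_words_lists by blast
  have "v @ [i] \<in> rook_words n s" using rook_words_snoc[of v n s i] assms by simp
  then have "rook_cong n ((v @ [i]) @ [j]) (v @ [j])"
    using assms by (intro rook_cong_appendR) (auto intro: unique_wordD)
  moreover have "rook_cong n (v @ [j, i]) (v @ [i, j])"
    using assms v by (intro rook_cong_appendL rook_cong_commute) auto
  ultimately show ?thesis by (auto intro: gen_cong.trans)
qed

text \<open>If \<open>\<pi>\<^sub>i\<close> fixes \<open>r\<close> because of two adjacent zeros, the predecessor is found by undoing the step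
  that brought in the first zero of \<open>r\<close>. Its generator commutes with \<open>\<pi>\<^sub>i\<close>, unless its index is \<open>i - 1\<close>, when a
  braid relation (or \<open>0101 = 010\<close>, for \<open>i = 1\<close>) applies.\<close>

lemma absorbing_predecessor:
  assumes r: "r \<in> rooks n" and i: "i < n" and fix_r: "act_gen r i = r"
    and U: "\<And>s. s \<in> rooks n \<Longrightarrow> wt r < wt s \<Longrightarrow> unique_word n s"
  shows "\<exists>s\<in>rooks n. \<exists>j<n. \<exists>v\<in>rook_words n s.
    act_gen s j = r \<and> s \<noteq> r \<and> rook_cong n (v @ [j, i]) (v @ [j])"
proof -
  have len: "length r = n" using r by (simp add: rooks_def)
  \<comment> \<open>If \<open>\<pi>\<^sub>i\<close> itself leads into \<open>r\<close> from another
    rook, its repetition is absorbed by idempotence.\<close>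
  have idem: ?thesis if s: "s \<in> rooks n" "act_gen s i = r" "s \<noteq> r" for s
  proof -
    obtain v where v: "v \<in> rook_words n s" using rook_words_nonempty[OF s(1)] .
    then have "rook_cong n (v @ [i, i]) (v @ [i])"
      using i rook_words_lists rook_cong_idem by (intro rook_cong_appendL)
    then show ?thesis using s i v by blast
  qed
  have far: ?thesis if s: "s \<in> rooks n" "act_gen s j = r" "s \<noteq> r" and j: "j + 2 \<le> i"
    and "act_gen s i = s" for s j
  proof -
    obtain v where v: "v \<in> rook_words n s" using rook_words_nonempty[OF s(1)] .
    have "wt r < wt s" using wt_act_gen_less[of j s] s j i by (auto simp: rooks_def)
    then have "rook_cong n (v @ [j, i]) (v @ [j])"
      using absorbed_far[of n s i j v] that U v i by auto
    moreover have "j < n" using j i by simp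
    ultimately show ?thesis using that v by blast
  qed
  from i len have "i < length r" by simp
  then show ?thesis
  proof (cases rule: act_gen_cases)
    case (zero x ys)
    then have r': "r = 0 # ys" using fix_r by simp
    then obtain x where "0 < x" "x # ys \<in> rooks n" using missing_letter r by metis
    then show ?thesis using idem[of "x # ys"] zero r' by simp
  next
    case (swap xs a b ys)
    have "max a b = a" using swap fix_r by simp
    then have "b \<le> a" by simp
    show ?thesis
    proof (cases "b < a")
      case True
      have "xs @ b # a # ys \<in> rooks n" by (rule rooks_mset[OF _ r]) (simp add: swap)
      moreover have "act_gen (xs @ b # a # ys) i = r" using act_gen_swap[of b a xs ys] True swap by simp
      ultimately show ?thesis using idem[of "xs @ b # a # ys"] True swap by simp
    next
      case False
      with \<open>b \<le> a\<close> have "a = b" by simp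
      moreover have "a = 0" using r swap(2) \<open>a = b\<close> by (cases "a = 0") (auto simp: rooks_def)
      ultimately have r0: "r = xs @ 0 # 0 # ys" using swap by simp
      have fix0: "act_gen (p @ 0 # 0 # ys) (Suc (length p)) = p @ 0 # 0 # ys" for p
        by (simp add: act_gen_swap del: act_gen.simps)
      show ?thesis
      proof (cases "xs = [] \<or> hd xs = 0")
        case True
        then consider "xs = []" | xs' where "xs = 0 # xs'" by (cases xs) auto
        then show ?thesis
        proof cases
          \<comment> \<open>Here \<open>i\<close> is 1 and both zeros lead. \<open>r\<close> is
            reached from \<open>x # y # ys\<close> by 010 through \<open>y # 0 # ys\<close>, and
            0101 = 010 absorbs \<open>i\<close>.\<close>
          case 1
          then obtain x y where xy: "0 < x" "x < y" and c: "x # y # ys \<in> rooks n"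
            using two_missing_letters r r0 by (metis append_Nil)
          obtain \<omega> where \<omega>: "\<omega> \<in> rook_words n (x # y # ys)" using rook_words_nonempty[OF c] .
          have n: "2 \<le> n" using len r0 by simp
          have s: "y # 0 # ys \<in> rooks n"
            by (rule rooks_mset[OF _ rooks_zero[OF c]]) simp
          have "\<omega> @ [0, Suc 0] \<in> rook_words n (y # 0 # ys)"
            using n xy by (intro rook_words_append[OF \<omega>]) (auto simp: act_word_def)
          moreover have "rook_cong n ((\<omega> @ [0, Suc 0]) @ [0, i]) ((\<omega> @ [0, Suc 0]) @ [0])"
            using rook_cong_appendL[OF rook_cong_zero(2)[OF n] rook_words_lists[OF \<omega>]] swap 1 by simp
          ultimately show ?thesis
            using s n xy r0 1 by (intro bexI[of _ "y # 0 # ys"] exI[of _ 0] conjI bexI[of _ "\<omega> @ [0, Suc 0]"]) auto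
        next
          \<comment> \<open>Undoing the leading zero keeps the adjacent pair, which lies further
            right, so \<open>i\<close> is at least 2 and commutes with
            \<open>\<pi>\<^sub>0\<close>.\<close>
          case 2
          then obtain x where x: "0 < x" "x # xs' @ 0 # 0 # ys \<in> rooks n"
            using missing_letter r r0 by (metis append_Cons)
          then show ?thesis
            using far[of "x # xs' @ 0 # 0 # ys" 0] fix0[of "x # xs'"] swap(1) r0 2
            by (simp del: act_gen.simps(2))
        qed
      next
        case False
        \<comment> \<open>The appended zero is the first of the adjacent pair. The first zero of
          \<open>r\<close> is to be exchanged with its left neighbour; \<open>q\<close> is empty
          exactly if that zero belongs to the pair.\<close>
        obtain p0 q where pq: "xs @ [0] = p0 @ 0 # q" "0 \<notin> set p0"
          using split_list_first[of 0 "xs @ [0]"] by auto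
        have "p0 \<noteq> []"
        proof
          assume "p0 = []"
          then have "hd (xs @ [0]) = 0" using pq by simp
          then show False using False by simp
        qed
        then obtain p c where p0: "p0 = p @ [c]" by (cases p0 rule: rev_cases) auto
        then have c: "0 < c" using pq by auto
        show ?thesis
        proof (cases q rule: rev_cases)
          case Nil
          then have xs: "xs = p @ [c]" using pq p0 by simp
          let ?k = "Suc (length p)"
          \<comment> \<open>In \<open>?t\<close> both zeros stand left of \<open>c\<close>, so
            \<open>?k\<close> fixes \<open>?t\<close> and is absorbed by \<open>\<omega>\<close>.
            The braid relation then takes \<open>\<omega> @ [i, ?k, i]\<close> to
            \<open>\<omega> @ [?k, i, ?k]\<close>, hence to
            \<open>\<omega> @ [i, ?k]\<close>.\<close>
          let ?s = "p @ 0 # c # 0 # ys" and ?t = "p @ 0 # 0 # c # ys"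
          have r1: "r = p @ c # 0 # 0 # ys" using r0 xs by simp
          have ik: "i = Suc ?k" using swap xs by simp
          have s: "?s \<in> rooks n" "?t \<in> rooks n" by (rule rooks_mset[OF _ r]; simp add: r1)+
          have sr: "act_gen ?s ?k = r" using act_gen_swap[of 0 c p "0 # ys"] r1 by (simp del: act_gen.simps)
          have s0s: "act_gen ?t i = ?s"
            using act_gen_swap[of 0 c "p @ [0]" ys] ik by (simp del: act_gen.simps)
          have "wt r < wt ?s" using wt_swap[OF c, of p "0 # ys"] r1 by simp
          also have "wt ?s < wt ?t" using wt_swap[OF c, of "p @ [0]" ys] by simp
          finally have U0: "unique_word n ?t" using U s by blast
          obtain \<omega> where \<omega>: "\<omega> \<in> rook_words n ?t" using rook_words_nonempty[OF s(2)] .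
          have \<omega>l: "\<omega> \<in> lists {..<n}" using rook_words_lists[OF \<omega>] .
          have k: "?k < n" using i ik by simp
          have "\<omega> @ [?k] \<in> rook_words n ?t"
            using rook_words_snoc[OF \<omega> k] by (simp add: act_gen_swap del: act_gen.simps)
          then have "rook_cong n (\<omega> @ [?k]) \<omega>" using U0 \<omega> by (auto intro: unique_wordD)
          then have "rook_cong n ((\<omega> @ [?k]) @ [i, ?k]) (\<omega> @ [i, ?k])"
            using i k by (intro rook_cong_appendR) auto
          moreover have "rook_cong n (\<omega> @ [i, ?k, i]) (\<omega> @ [?k, i, ?k])"
            using gen_cong.sym[OF rook_cong_braid[of ?k n]] ik i \<omega>l by (intro rook_cong_appendL) auto
          ultimately have "rook_cong n ((\<omega> @ [i]) @ [?k, i]) ((\<omega> @ [i]) @ [?k])"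
            by (auto intro: gen_cong.trans)
          moreover have "\<omega> @ [i] \<in> rook_words n ?s" using rook_words_snoc[OF \<omega> i] unfolding s0s .
          moreover have "?s \<noteq> r" using r1 c by simp
          ultimately show ?thesis using s k sr by blast
        next
          case (snoc q' z)
          then have xs: "xs = p @ c # 0 # q'" using pq p0 by simp
          let ?s = "p @ 0 # c # q' @ 0 # 0 # ys"
          have "?s \<in> rooks n" by (rule rooks_mset[OF _ r]) (simp add: r0 xs)
          moreover have "act_gen ?s (Suc (length p)) = r"
            using act_gen_swap[of 0 c p "q' @ 0 # 0 # ys"] r0 xs by (simp del: act_gen.simps)
          moreover have "act_gen ?s i = ?s"
            using fix0[of "p @ 0 # c # q'"] swap(1) xs by (simp del: act_gen.simps)
          ultimately show ?thesis using far[of ?s "Suc (length p)"] swap(1) r0 xs c by (simp del: act_gen.simps)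
        qed
      qed
    qed
  qed
qed

section \<open>Uniqueness of words up to congruence\<close>

lemma act_gen_one_rook_neq:
  assumes "i < n"
  shows "act_gen (one_rook n) i \<noteq> one_rook n"
proof
  assume *: "act_gen (one_rook n) i = one_rook n"
  have "sorted_wrt (<) (one_rook n)" by (simp add: one_rook_def del: upt_Suc)
  have "0 \<notin> set (one_rook n)" by (simp add: one_rook_def del: upt_Suc)
  from assms have "i < length (one_rook n)" by (simp add: one_rook_def del: upt_Suc)
  then show False
  proof (cases rule: act_gen_cases)
    case (zero x ys)
    then show ?thesis using * \<open>0 \<notin> set (one_rook n)\<close> by (metis list.set_intros(1))
  next
    case (swap xs a b ys)
    then have "max a b = a" using * by (metis list.inject same_append_eq)
    moreover have "a < b" using \<open>sorted_wrt (<) (one_rook n)\<close> unfolding swap(2)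
      by (simp add: sorted_wrt_append)
    ultimately show ?thesis by simp
  qed
qed

text \<open>The identity rook has maximal weight and every generator moves it, so no step can end
  there. This is the base case of the induction.\<close>

lemma rook_words_one_rook:
  assumes "w \<in> rook_words n (one_rook n)"
  shows "w = []"
proof (rule ccontr)
  assume "w \<noteq> []"
  then obtain v i where w: "w = v @ [i]" by (cases w rule: rev_cases) auto
  let ?s = "act_word (one_rook n) v"
  have v: "v \<in> lists {..<n}" "i < n" and e: "act_gen ?s i = one_rook n"
    using assms w by (auto simp: rook_words_def act_word_def)
  have s: "?s \<in> rooks n" using v one_rook_rooks act_word_rooks by blast
  then have "?s = one_rook n"
    using e v wt_rook_le[OF s] wt_act_gen_less[of i ?s] by (force simp: rooks_def)
  then show False using e v act_gen_one_rook_neq by simp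
qed

text \<open>A word for \<open>r\<close> may end in letters that fix \<open>r\<close>; up to
  congruence these can be removed until the last step moves a rook.\<close>

lemma strict_predecessor:
  assumes r: "r \<in> rooks n" "r \<noteq> one_rook n"
    and U: "\<And>s. s \<in> rooks n \<Longrightarrow> wt r < wt s \<Longrightarrow> unique_word n s"
    and w: "w \<in> rook_words n r"
  shows "\<exists>s\<in>rooks n. \<exists>j<n. \<exists>v\<in>rook_words n s. act_gen s j = r \<and> s \<noteq> r \<and> rook_cong n w (v @ [j])"
  using w
proof (induction w rule: rev_induct)
  case Nil
  then show ?case using r by (simp add: rook_words_def act_word_def)
next
  case (snoc i w)
  let ?s = "act_word (one_rook n) w"
  have w: "w \<in> lists {..<n}" "i < n" and e: "act_gen ?s i = r"
    using snoc.prems by (auto simp: rook_words_def act_word_def)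
  have s: "?s \<in> rooks n" and ws: "w \<in> rook_words n ?s"
    using w one_rook_rooks act_word_rooks by (auto simp: rook_words_def)
  show ?case
  proof (cases "?s = r")
    case False
    have "rook_cong n (w @ [i]) (w @ [i])" using w by (intro gen_cong.refl) auto
    then show ?thesis using s ws w e False by blast
  next
    \<comment> \<open>The prefix \<open>w\<close> already reaches \<open>r\<close>. It is congruent
      to a word ending in the step from \<open>absorbing_predecessor\<close>, and that word absorbs
      \<open>i\<close>.\<close>
    case True
    then obtain s j v where 1: "s \<in> rooks n" "j < n" "v \<in> rook_words n s" "act_gen s j = r" "s \<noteq> r"
      "rook_cong n w (v @ [j])" using snoc.IH ws by auto
    obtain t k u where 2: "t \<in> rooks n" "k < n" "u \<in> rook_words n t" "act_gen t k = r" "t \<noteq> r"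
      "rook_cong n (u @ [k, i]) (u @ [k])"
      using absorbing_predecessor[OF r(1) w(2) _ U] e True by auto
    have "wt r < wt s" using 1 wt_act_gen_less[of j s] by (auto simp: rooks_def)
    moreover have "wt r < wt t" using 2 wt_act_gen_less[of k t] by (auto simp: rooks_def)
    ultimately have "rook_cong n (v @ [j]) (u @ [k])"
      using 1 2 by (intro rook_cong_predecessors[of s n t] U) auto
    with 1(6) have *: "rook_cong n w (u @ [k])" by (rule gen_cong.trans)
    have "rook_cong n (w @ [i]) ((u @ [k]) @ [i])"
      using w by (intro rook_cong_appendR[OF *]) auto
    then have "rook_cong n (w @ [i]) (u @ [k])"
      using 2(6) by (auto intro: gen_cong.trans)
    then show ?thesis using 2 by blast
  qed
qed

text \<open>Up to congruence both words end in strict steps from heavier rooks, where uniqueness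
  holds by induction, so \<open>rook_cong_predecessors\<close> compares them.\<close>

lemma unique_word_rook:
  assumes "r \<in> rooks n"
  shows "unique_word n r"
  using assms
proof (induction r rule: measure_induct_rule[where f = "\<lambda>r. wt (one_rook n) - wt r"])
  case (less r)
  have U: "unique_word n s" if "s \<in> rooks n" "wt r < wt s" for s
    using less.IH[of s] that wt_rook_le[OF that(1)] by simp
  show ?case unfolding unique_word_def
  proof (intro ballI)
    fix w w' assume w: "w \<in> rook_words n r" "w' \<in> rook_words n r"
    show "rook_cong n w w'"
    proof (cases "r = one_rook n")
      case True
      then have "w = []" "w' = []" using w rook_words_one_rook by blast+
      then show ?thesis by (simp add: gen_cong.refl)
    next
      case False
      obtain s j v where 1: "s \<in> rooks n" "j < n" "v \<in> rook_words n s" "act_gen s j = r" "s \<noteq> r"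
        "rook_cong n w (v @ [j])" using strict_predecessor[OF less.prems False U w(1)] by auto
      obtain t k u where 2: "t \<in> rooks n" "k < n" "u \<in> rook_words n t" "act_gen t k = r" "t \<noteq> r"
        "rook_cong n w' (u @ [k])" using strict_predecessor[OF less.prems False U w(2)] by auto
      have "wt r < wt s" using 1 wt_act_gen_less[of j s] by (auto simp: rooks_def)
      moreover have "wt r < wt t" using 2 wt_act_gen_less[of k t] by (auto simp: rooks_def)
      ultimately have "rook_cong n (v @ [j]) (u @ [k])"
        using 1 2 by (intro rook_cong_predecessors[of s n t] U) auto
      then show ?thesis using 1(6) 2(6) by (blast intro: gen_cong.trans gen_cong.sym)
    qed
  qed
qed


section \<open>The order on the monoid\<close>

abbreviation word_class :: "nat \<Rightarrow> nat list \<Rightarrow> nat list set" where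
  "word_class n w \<equiv> gen_cong {..<n} (rook_rels n) `` {w}"

lemma carrier_rook_monoid0: "carrier (rook_monoid0 n) = word_class n ` lists {..<n}"
  by (auto simp: rook_monoid0_def presented_monoid_def quotient_def)

lemma word_class_eq_iff:
  assumes "v \<in> lists {..<n}" "w \<in> lists {..<n}"
  shows "word_class n v = word_class n w \<longleftrightarrow> act_word (one_rook n) v = act_word (one_rook n) w"
proof
  assume "word_class n v = word_class n w"
  then show "act_word (one_rook n) v = act_word (one_rook n) w"
    using assms rook_act_class[OF one_rook_rooks] by metis
next
  assume "act_word (one_rook n) v = act_word (one_rook n) w"
  then have "rook_cong n v w"
    using assms act_word_rooks[OF one_rook_rooks] by (intro unique_wordD[OF unique_word_rook]) (auto simp: rook_words_def)
  then show "word_class n v = word_class n w" by (rule equiv_class_eq[OF equiv_gen_cong])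
qed

text \<open>The description is legitimate: any word for \<open>r\<close> gives such a class, and by
  faithfulness there is no other.\<close>

lemma rook_elem_eq:
  assumes "w \<in> rook_words n r"
  shows "rook_elem n r = word_class n w"
  unfolding rook_elem_def
proof (rule the_equality)
  have w: "w \<in> lists {..<n}" "act_word (one_rook n) w = r"
    using assms by (auto simp: rook_words_def)
  then show "word_class n w \<in> carrier (rook_monoid0 n) \<and> rook_act (one_rook n) (word_class n w) = r"
    using rook_act_class[OF one_rook_rooks w(1)] by (simp add: carrier_rook_monoid0)
  fix X assume X: "X \<in> carrier (rook_monoid0 n) \<and> rook_act (one_rook n) X = r"
  then obtain v where v: "v \<in> lists {..<n}" "X = word_class n v" by (auto simp: carrier_rook_monoid0)
  then have "act_word (one_rook n) v = r" using X rook_act_class[OF one_rook_rooks v(1)] by simp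
  then show "X = word_class n w" using v w word_class_eq_iff by simp
qed

lemma (in monoid) R_le_iff:
  assumes "x \<in> carrier G" "y \<in> carrier G"
  shows "R_le G x y \<longleftrightarrow> (\<exists>m\<in>carrier G. x = y \<otimes> m)"
proof
  assume "R_le G x y"
  moreover have "x \<in> x <# carrier G"
    unfolding l_coset_def using assms r_one[of x] by (metis UN_I one_closed singletonI)
  ultimately show "\<exists>m\<in>carrier G. x = y \<otimes> m" by (auto simp: R_le_def l_coset_def)
next
  assume "\<exists>m\<in>carrier G. x = y \<otimes> m"
  then show "R_le G x y" using assms by (force simp: R_le_def l_coset_def m_assoc)
qed

theorem theorem4p16:
  fixes n :: nat and r u :: "nat list"
  assumes "r \<in> rooks n" and "u \<in> rooks n"
  shows "R_le (rook_monoid0 n) (rook_elem n r) (rook_elem n u) \<longleftrightarrow> r \<le>\<^sub>I u"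
proof -
  interpret monoid "rook_monoid0 n"
    unfolding rook_monoid0_def by (rule monoid_presented_monoid)
  obtain a where a: "a \<in> rook_words n r" using rook_words_nonempty[OF assms(1)] .
  obtain b where b: "b \<in> rook_words n u" using rook_words_nonempty[OF assms(2)] .
  have ab: "a \<in> lists {..<n}" "b \<in> lists {..<n}" using a b rook_words_lists by blast+
  have mult: "word_class n b \<otimes>\<^bsub>rook_monoid0 n\<^esub> word_class n w = word_class n (b @ w)"
    if "w \<in> lists {..<n}" for w
    unfolding rook_monoid0_def using ab(2) that by (rule presented_monoid_mult_class)
  have "R_le (rook_monoid0 n) (rook_elem n r) (rook_elem n u) \<longleftrightarrow>
      (\<exists>m\<in>carrier (rook_monoid0 n). word_class n a = word_class n b \<otimes>\<^bsub>rook_monoid0 n\<^esub> m)"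
    unfolding rook_elem_eq[OF a] rook_elem_eq[OF b]
    by (rule R_le_iff) (use ab in \<open>auto simp: carrier_rook_monoid0\<close>)
  also have "\<dots> \<longleftrightarrow> (\<exists>w\<in>lists {..<n}. word_class n a = word_class n (b @ w))"
    using mult by (auto simp: carrier_rook_monoid0)
  \<comment> \<open>Since \<open>b\<close> sends the identity rook to \<open>u\<close>, faithfulness
    turns right multiples of its class into points of the orbit of \<open>u\<close>.\<close>
  also have "\<dots> \<longleftrightarrow> (\<exists>w\<in>lists {..<n}. r = act_word u w)"
  proof (rule bex_cong[OF HOL.refl])
    fix w assume "w \<in> lists {..<n}"
    with ab have "b @ w \<in> lists {..<n}" by simp
    from word_class_eq_iff[OF ab(1) this]
    show "word_class n a = word_class n (b @ w) \<longleftrightarrow> r = act_word u w"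
      using a b by (simp add: act_word_append rook_words_def)
  qed
  also have "\<dots> \<longleftrightarrow> r \<le>\<^sub>I u"
    using rook_le_imp_act_word[OF assms] act_word_rook_le[OF assms(2)] by blast
  finally show ?thesis .
qed

end
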